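(* Let $G$ be a $3$-graph with vertex set $[t]$ and $m$ edges containing $[t-1]^{(3)}$. Then $G$ is dense if and only if $m \ge \binom{t-1}{3}+\binom{t-2}{2}+1$.
   Context: For a finite set $V$, $V^{(3)}$ denotes the family of all $3$-element subsets of $V$; $[n]=\{1,\dots,n\}$. A $3$-graph $G$ consists of a finite vertex set $V(G)$ and an edge set $E(G)\subseteq V(G)^{(3)}$. $H$ is a subgraph of $G$ if $V(H)\subseteq V(G)$ and $E(H)\subseteq E(G)$. $[n]^{(3)}$ also denotes the complete $3$-graph on the vertex set $[n]$; "$G$ contains $[t-1]^{(3)}$" means that every $3$-subset of $[t-1]$ is an edge of $G$. For a $3$-graph $G$ with vertex set $[n]$ and $\vec x=(x_1,\dots,x_n)\in\mathbb R^n$, let $\lambda(G,\vec x)=\sum_{e\in E(G)}\prod_{i\in e}x_i$. The Lagrangian of $G$ is $\lambda(G)=\max\{\lambda(G,\vec x): \sum_{i=1}^n x_i=1,\ x_i\ge 0 \text{ for all } i\}$ (and analogously for an arbitrary finite vertex set). A $3$-graph $G$ is dense if every proper subgraph $G'$ of $G$ satisfies $\lambda(G')<\lambda(G)$ (equivalently, no optimum weighting of $G$ has a zero coordinate). *)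

theory Defs
  imports "HOL-Analysis.Analysis" "HOL-Library.Ramsey"
begin

text \<open>
  A 3-graph is given by its vertex set \<open>V\<close> and its edge set \<open>E\<close>. The library's \<open>nsets V 3\<close>,
  also written \<open>[V]\<^bsup>3\<^esup>\<close>, is the family of all 3-element subsets of \<open>V\<close>.
\<close>

definition three_graph :: "'a set \<Rightarrow> 'a set set \<Rightarrow> bool"
  where "three_graph V E \<longleftrightarrow> finite V \<and> E \<subseteq> nsets V 3"

definition subgraph :: "'a set \<Rightarrow> 'a set set \<Rightarrow> 'a set \<Rightarrow> 'a set set \<Rightarrow> bool"
  where "subgraph V' E' V E \<longleftrightarrow> three_graph V' E' \<and> V' \<subseteq> V \<and> E' \<subseteq> E"

definition proper_subgraph :: "'a set \<Rightarrow> 'a set set \<Rightarrow> 'a set \<Rightarrow> 'a set set \<Rightarrow> bool"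
  where "proper_subgraph V' E' V E \<longleftrightarrow> subgraph V' E' V E \<and> (V', E') \<noteq> (V, E)"

definition lagrange_poly :: "'a set set \<Rightarrow> ('a \<Rightarrow> real) \<Rightarrow> real"
  where "lagrange_poly E x = (\<Sum>e\<in>E. \<Prod>i\<in>e. x i)"

text \<open>Values of a weighting outside \<open>V\<close> are unconstrained; they are irrelevant for edges within \<open>V\<close>.\<close>

definition weightings :: "'a set \<Rightarrow> ('a \<Rightarrow> real) set"
  where "weightings V = {x. (\<forall>i\<in>V. 0 \<le> x i) \<and> (\<Sum>i\<in>V. x i) = 1}"

text \<open>
  For nonempty \<open>V\<close> the supremum is a maximum, see \<open>lagrangian_attained\<close> below. The graph without
  vertices admits no weighting; its Lagrangian is \<open>0\<close> by convention.
\<close>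

definition lagrangian :: "'a set \<Rightarrow> 'a set set \<Rightarrow> real"
  where "lagrangian V E = (if V = {} then 0 else (SUP x\<in>weightings V. lagrange_poly E x))"

definition dense_three_graph :: "'a set \<Rightarrow> 'a set set \<Rightarrow> bool"
  where "dense_three_graph V E \<longleftrightarrow>
    (\<forall>V' E'. proper_subgraph V' E' V E \<longrightarrow> lagrangian V' E' < lagrangian V E)"

lemma lagrangian_attained:
  fixes V :: "'a set"
  assumes G: "three_graph V E" and ne: "V \<noteq> {}"
  shows "\<exists>x\<in>weightings V. lagrange_poly E x = lagrangian V E \<and>
           (\<forall>y\<in>weightings V. lagrange_poly E y \<le> lagrangian V E)"
proof -
  have fin: "finite V" and E: "E \<subseteq> nsets V 3"
    using G by (auto simp: three_graph_def)
  define B where "B = (\<lambda>i. if i \<in> V then {0..1::real} else {0})"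
  define K where "K = Pi\<^sub>E UNIV B \<inter> {x. (\<Sum>i\<in>V. x i) = 1}"
  have cont: "continuous_on UNIV (\<lambda>x::'a \<Rightarrow> real. x i)" for i
    by (intro continuous_on_product_coordinates)
  have "compactin (product_topology (\<lambda>i. euclidean) UNIV) (Pi\<^sub>E UNIV B)"
    by (subst compactin_PiE) (auto simp: B_def)
  then have "compact (Pi\<^sub>E UNIV B)"
    by (simp add: euclidean_product_topology)
  moreover have "closed {x::'a \<Rightarrow> real. (\<Sum>i\<in>V. x i) = 1}"
    by (intro closed_Collect_eq continuous_on_sum cont continuous_on_const)
  ultimately have compact: "compact K"
    unfolding K_def by (rule compact_Int_closed)
  obtain v where v: "v \<in> V" using ne by blast
  have "(\<lambda>i. if i = v then 1 else 0) \<in> K"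
    using v fin by (auto simp: K_def B_def PiE_def)
  then have Kne: "K \<noteq> {}" by blast
  have contP: "continuous_on K (lagrange_poly E)"
    unfolding lagrange_poly_def
    by (intro continuous_on_sum continuous_on_prod continuous_on_subset[OF cont]) auto
  obtain x where x: "x \<in> K" and max: "\<And>y. y \<in> K \<Longrightarrow> lagrange_poly E y \<le> lagrange_poly E x"
    using continuous_attains_sup[OF compact Kne contP] by blast
  have xW: "x \<in> weightings V"
    using x by (fastforce simp: K_def B_def weightings_def PiE_def Pi_def split: if_splits)
  have le: "lagrange_poly E y \<le> lagrange_poly E x" if y: "y \<in> weightings V" for y
  proof -
    define z where "z = (\<lambda>i. if i \<in> V then y i else 0)"
    have sum_y: "(\<Sum>i\<in>V. y i) = 1" and y0: "\<And>i. i \<in> V \<Longrightarrow> 0 \<le> y i"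
      using y by (auto simp: weightings_def)
    have "y i \<le> 1" if "i \<in> V" for i
      using member_le_sum[OF that _ fin, of y] y0 sum_y by auto
    then have "z \<in> K"
      using y0 sum_y by (auto simp: K_def B_def z_def PiE_def)
    moreover have "lagrange_poly E z = lagrange_poly E y"
      unfolding lagrange_poly_def z_def
      using E by (intro sum.cong prod.cong) (auto simp: nsets_def)
    ultimately show ?thesis using max by metis
  qed
  have "lagrangian V E = lagrange_poly E x"
    using ne xW le by (auto simp: lagrangian_def intro!: cSup_eq_maximum)
  then show ?thesis using xW le by auto
qed

end

theory Submission
  imports Defs
begin

text \<open>
  Let \<open>U\<close> be the vertex set without the last vertex \<open>v\<close>, let \<open>n = card U\<close>, and let
  \<open>\<kappa> = (n choose 3) / n ^ 3\<close>. By Maclaurin's inequality (\<open>lagrange_poly_complete_le\<close>), \<open>\<kappa>\<close> is the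
  Lagrangian of the complete 3-graph on \<open>n\<close> vertices, and so it bounds the value of every weighting
  that vanishes somewhere on the \<open>n + 1\<close> vertices. Therefore \<open>G\<close> is dense exactly when its Lagrangian
  exceeds \<open>\<kappa>\<close>: if it does, every optimum weighting is positive everywhere, and removing a vertex
  or an edge loses value; if it does not, the complete 3-graph on \<open>U\<close> is a proper subgraph that
  already attains it. As \<open>G\<close> contains the complete 3-graph on \<open>U\<close>, its number of edges is
  \<open>n choose 3\<close> plus the number of pairs in the link of \<open>v\<close>. It remains to show that the Lagrangian
  exceeds \<open>\<kappa>\<close> if and only if the link of \<open>v\<close> has more than \<open>(n - 1) choose 2\<close> pairs.

  The tool for both directions is the first-order condition \<open>optimum_link_le\<close>: the Lagrange polynomial
  of the link of \<open>i\<close> is the partial derivative in the direction of \<open>i\<close>, and at an optimum weighting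
  no partial derivative exceeds that of a vertex of positive weight.

  If the link of \<open>v\<close> is large, take the uniform weighting of \<open>U\<close>, whose value is \<open>\<kappa>\<close>. Its partial
  derivative is \<open>card (link E v) / n\<^sup>2\<close> at \<open>v\<close> and \<open>((n - 1) choose 2) / n\<^sup>2\<close> on \<open>U\<close>, so it is
  not an optimum.

  If the link of \<open>v\<close> is small, consider an optimum weighting \<open>x\<close>. Only the case that \<open>x\<close> is positive
  everywhere needs an argument. Let \<open>u\<close> be a lightest vertex of \<open>U\<close>. If no edge contains both \<open>v\<close>
  and \<open>u\<close>, then moving the weight of \<open>v\<close> to \<open>u\<close> gives a weighting of the complete 3-graph on \<open>U\<close>
  that is at least as good (\<open>lagrange_poly_le_of_uncovered_pair\<close>), so the value is at most \<open>\<kappa>\<close>.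
  Otherwise such an optimum does not exist (\<open>card_link_of_positive_optimum\<close>): all partial derivatives
  agree, and comparing those of \<open>v\<close>, of \<open>u\<close> and of the heaviest vertex that forms an edge with both
  contradicts the abundance of pairs that are missing from the link of \<open>v\<close>.
\<close>

section \<open>Lagrange polynomials and links\<close>

text \<open>
  Since the Lagrange polynomial is affine in every coordinate, the Lagrange polynomial of the link
  of \<open>i\<close> is its partial derivative with respect to \<open>x i\<close>.
\<close>

definition link :: "'a set set \<Rightarrow> 'a \<Rightarrow> 'a set set"
  where "link E i = (\<lambda>e. e - {i}) ` {e \<in> E. i \<in> e}"

lemma lagrange_poly_cong:
  assumes "\<And>i. i \<in> \<Union>E \<Longrightarrow> x i = y i"
  shows "lagrange_poly E x = lagrange_poly E y"
  unfolding lagrange_poly_def using assms by (intro sum.cong prod.cong) auto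

lemma lagrange_poly_mono:
  assumes "finite E'" "E \<subseteq> E'" "\<And>i. i \<in> \<Union>E' \<Longrightarrow> 0 \<le> x i"
  shows "lagrange_poly E x \<le> lagrange_poly E' x"
  unfolding lagrange_poly_def using assms by (intro sum_mono2 prod_nonneg) auto

lemma lagrange_poly_Un_disjoint:
  assumes "finite A" "finite B" "A \<inter> B = {}"
  shows "lagrange_poly (A \<union> B) x = lagrange_poly A x + lagrange_poly B x"
  unfolding lagrange_poly_def using assms by (rule sum.union_disjoint)

lemma lagrange_poly_pairs:
  assumes "v \<notin> A"
  shows "lagrange_poly ((\<lambda>k. {v, k}) ` A) x = x v * (\<Sum>k\<in>A. x k)"
proof -
  have inj: "inj_on (\<lambda>k. {v, k}) A"
    unfolding inj_on_def doubleton_eq_iff by blast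
  have "(\<Prod>i\<in>{v, k}. x i) = x v * x k" if "k \<in> A" for k
    using that assms by (subst prod.insert) auto
  then show ?thesis
    unfolding lagrange_poly_def by (simp add: sum.reindex[OF inj] sum_distrib_left)
qed

lemma lagrange_poly_const:
  fixes b :: real
  assumes "E \<subseteq> nsets V k" "\<And>i. i \<in> V \<Longrightarrow> x i = b"
  shows "lagrange_poly E x = card E * b ^ k"
proof -
  have "(\<Prod>i\<in>e. x i) = b ^ k" if "e \<in> E" for e
  proof -
    have "e \<subseteq> V" "card e = k" using that assms(1) by (auto simp: nsets_def)
    then have "(\<Prod>i\<in>e. x i) = (\<Prod>i\<in>e. b)" by (intro prod.cong refl) (auto simp: assms(2))
    then show ?thesis by (simp add: \<open>card e = k\<close>)
  qed
  then show ?thesis by (simp add: lagrange_poly_def)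
qed

lemma lagrange_poly_ge_const:
  fixes b :: real
  assumes "E \<subseteq> nsets V k" "\<And>i. i \<in> V \<Longrightarrow> b \<le> x i" "0 \<le> b"
  shows "card E * b ^ k \<le> lagrange_poly E x"
proof -
  have "lagrange_poly E (\<lambda>_. b) \<le> lagrange_poly E x"
    unfolding lagrange_poly_def using assms by (intro sum_mono prod_mono) (auto simp: nsets_def subset_iff)
  then show ?thesis by (subst (asm) lagrange_poly_const[OF assms(1)]) auto
qed

lemma lagrange_poly_link:
  assumes "finite E" "\<And>e. e \<in> E \<Longrightarrow> finite e"
  shows "lagrange_poly E x = lagrange_poly {e \<in> E. i \<notin> e} x + x i * lagrange_poly (link E i) x"
proof -
  have inj: "inj_on (\<lambda>e. e - {i}) {e \<in> E. i \<in> e}"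
    unfolding inj_on_def by blast
  have "E = {e \<in> E. i \<notin> e} \<union> {e \<in> E. i \<in> e}" by blast
  then have "lagrange_poly E x = lagrange_poly {e \<in> E. i \<notin> e} x + lagrange_poly {e \<in> E. i \<in> e} x"
    using assms(1) lagrange_poly_Un_disjoint[of "{e \<in> E. i \<notin> e}" "{e \<in> E. i \<in> e}" x] by auto
  moreover have "lagrange_poly {e \<in> E. i \<in> e} x = x i * lagrange_poly (link E i) x"
  proof -
    have "(\<Prod>k\<in>e. x k) = x i * (\<Prod>k\<in>e - {i}. x k)" if "e \<in> {e \<in> E. i \<in> e}" for e
      using that assms(2) by (intro prod.remove) auto
    then show ?thesis
      unfolding lagrange_poly_def link_def by (simp add: sum.reindex[OF inj] sum_distrib_left)
  qed
  ultimately show ?thesis by simp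
qed

lemma Union_link: "i \<notin> \<Union>(link E i)" "\<Union>(link E i) \<subseteq> \<Union>E"
  by (auto simp: link_def)

lemma link_nsets_subset:
  assumes "E \<subseteq> nsets V (Suc k)"
  shows "link E i \<subseteq> nsets (V - {i}) k"
  using assms by (fastforce simp: link_def nsets_def)

lemma card_link:
  "card (link E i) = card {e \<in> E. i \<in> e}"
  unfolding link_def by (rule card_image) (unfold inj_on_def, blast)

text \<open>
  \<open>S\<close> is the mixed second derivative, the Lagrange polynomial of the common link of \<open>i\<close> and \<open>j\<close>.
\<close>

lemma lagrange_poly_two_coordinates:
  assumes "finite E" "\<And>e. e \<in> E \<Longrightarrow> finite e" "i \<noteq> j"
  obtains P Q R S where
    "\<And>b c. lagrange_poly E (x(i := b, j := c)) = P + b * Q + c * R + b * c * S"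
    "lagrange_poly (link E i) x = Q + x j * S"
    "lagrange_poly (link E j) x = R + x i * S"
proof -
  define Ei where "Ei = {e \<in> E. i \<notin> e}"
  define Li where "Li = link E i"
  have fin: "finite Ei" "finite Li" "\<And>e. e \<in> Ei \<Longrightarrow> finite e" "\<And>e. e \<in> Li \<Longrightarrow> finite e"
    using assms by (auto simp: Ei_def Li_def link_def)
  have free: "lagrange_poly A (x(i := b, j := c)) = lagrange_poly A x"
    if "i \<notin> \<Union>A" "j \<notin> \<Union>A" for A b c
    using that by (intro lagrange_poly_cong) auto
  define P where "P = lagrange_poly {e \<in> Ei. j \<notin> e} x"
  define R where "R = lagrange_poly (link Ei j) x"
  define Q where "Q = lagrange_poly {e \<in> Li. j \<notin> e} x"
  define S where "S = lagrange_poly (link Li j) x"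
  have i_free: "i \<notin> \<Union>Ei" "i \<notin> \<Union>Li"
    by (auto simp: Ei_def Li_def link_def)
  have split: "lagrange_poly A (x(i := b, j := c))
      = lagrange_poly {e \<in> A. j \<notin> e} x + c * lagrange_poly (link A j) x"
    if A: "finite A" "\<And>e. e \<in> A \<Longrightarrow> finite e" "i \<notin> \<Union>A" for A b c
  proof -
    have "lagrange_poly {e \<in> A. j \<notin> e} (x(i := b, j := c)) = lagrange_poly {e \<in> A. j \<notin> e} x"
      using A(3) by (intro free) auto
    moreover have "lagrange_poly (link A j) (x(i := b, j := c)) = lagrange_poly (link A j) x"
      using A(3) Union_link[where i = j and E = A] by (intro free) blast+
    ultimately show ?thesis
      using lagrange_poly_link[OF A(1,2), of "x(i := b, j := c)" j] by simp
  qed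
  have Ei: "lagrange_poly Ei (x(i := b, j := c)) = P + c * R" for b c
    unfolding P_def R_def by (rule split[OF fin(1,3) i_free(1)])
  have Li: "lagrange_poly Li (x(i := b, j := c)) = Q + c * S" for b c
    unfolding Q_def S_def by (rule split[OF fin(2,4) i_free(2)])
  have main: "lagrange_poly E (x(i := b, j := c)) = P + b * Q + c * R + b * c * S" for b c
    using lagrange_poly_link[OF assms(1,2), of "x(i := b, j := c)" i] assms(3) Ei[of b c] Li[of b c]
    by (simp add: Ei_def Li_def algebra_simps)
  have 1: "lagrange_poly (link E i) x = Q + x j * S"
    using Li[of "x i" "x j"] by (simp add: Li_def)
  have "lagrange_poly (link E j) (x(i := x i, j := c)) = lagrange_poly (link E j) x"
    "lagrange_poly {e \<in> E. j \<notin> e} (x(i := x i, j := c)) = lagrange_poly {e \<in> E. j \<notin> e} x" for c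
    using Union_link[where i = j and E = E] by (auto intro!: lagrange_poly_cong)
  then have "lagrange_poly E (x(i := x i, j := c))
      = lagrange_poly {e \<in> E. j \<notin> e} x + c * lagrange_poly (link E j) x" for c
    using lagrange_poly_link[OF assms(1,2), of "x(i := x i, j := c)" j] by simp
  from this[of 0] this[of 1] main[of "x i" 0] main[of "x i" 1]
  have 2: "lagrange_poly (link E j) x = R + x i * S" by (simp add: algebra_simps)
  from main 1 2 show ?thesis by (rule that)
qed

section \<open>The first-order condition at an optimum weighting\<close>

lemma three_graphD:
  assumes "three_graph V E"
  shows "finite V" "E \<subseteq> nsets V 3" "finite E" "\<And>e. e \<in> E \<Longrightarrow> finite e" "\<Union>E \<subseteq> V"
proof -
  show 1: "finite V" "E \<subseteq> nsets V 3" using assms by (auto simp: three_graph_def)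
  then show "finite E" using finite_imp_finite_nsets finite_subset by blast
  show "\<And>e. e \<in> E \<Longrightarrow> finite e" "\<Union>E \<subseteq> V" using 1 by (auto simp: nsets_def)
qed

text \<open>
  The Lagrange multiplier rule for the simplex. Moving weight \<open>h\<close> from \<open>i\<close> to \<open>j\<close> changes the value
  by \<open>h * (d - h * S)\<close>, where \<open>d\<close> is the difference of the two partial derivatives; if \<open>d\<close> were positive,
  a small \<open>h\<close> would be an improvement.
\<close>

lemma optimum_link_le:
  assumes G: "three_graph V E" and x: "x \<in> weightings V"
    and opt: "\<And>z. z \<in> weightings V \<Longrightarrow> lagrange_poly E z \<le> lagrange_poly E x"
    and ij: "i \<in> V" "j \<in> V" and pos: "0 < x i"
  shows "lagrange_poly (link E j) x \<le> lagrange_poly (link E i) x"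
proof (rule ccontr)
  assume neg: "\<not> ?thesis"
  then have "i \<noteq> j" by auto
  note fin = three_graphD[OF G]
  obtain P Q R S where f: "\<And>b c. lagrange_poly E (x(i := b, j := c)) = P + b * Q + c * R + b * c * S"
    and di: "lagrange_poly (link E i) x = Q + x j * S"
    and dj: "lagrange_poly (link E j) x = R + x i * S"
    using lagrange_poly_two_coordinates[OF fin(3,4) \<open>i \<noteq> j\<close>, of x] by blast
  define d where "d = lagrange_poly (link E j) x - lagrange_poly (link E i) x"
  have "d > 0" using neg by (simp add: d_def)
  have le: "d \<le> h * S" if h: "0 < h" "h \<le> x i" for h
  proof -
    define z where "z = x(i := x i - h, j := x j + h)"
    have V: "V = insert i (insert j (V - {i, j}))" using ij by blast
    have "sum x V = x i + (x j + sum x (V - {i, j}))"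
      using \<open>i \<noteq> j\<close> fin(1) by (subst V) simp
    moreover have "sum z V = z i + (z j + sum z (V - {i, j}))"
      using \<open>i \<noteq> j\<close> fin(1) by (subst V) simp
    moreover have "sum z (V - {i, j}) = sum x (V - {i, j})"
      by (intro sum.cong) (auto simp: z_def)
    ultimately have "sum z V = sum x V" using \<open>i \<noteq> j\<close> by (simp add: z_def)
    then have "z \<in> weightings V"
      using x h ij by (auto simp: weightings_def z_def)
    from opt[OF this] have "lagrange_poly E z \<le> lagrange_poly E (x(i := x i, j := x j))" by simp
    then have "h * d \<le> h * (h * S)"
      unfolding z_def f d_def di dj by (simp add: algebra_simps)
    then show ?thesis using h by simp
  qed
  have "S > 0" using le[OF pos order_refl] \<open>d > 0\<close> pos
    by (metis less_le_trans zero_less_mult_pos)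
  define h where "h = min (x i) (d / (2 * S))"
  have "0 < h" "h \<le> x i" using pos \<open>d > 0\<close> \<open>S > 0\<close> by (auto simp: h_def)
  from le[OF this] have "d \<le> h * S" .
  also have "\<dots> \<le> d / (2 * S) * S" using \<open>S > 0\<close> by (intro mult_right_mono) (auto simp: h_def)
  also have "\<dots> = d / 2" using \<open>S > 0\<close> by simp
  finally show False using \<open>d > 0\<close> by simp
qed

section \<open>Complete graphs\<close>

lemma lagrange_poly_nsets_insert:
  assumes "finite U" "v \<notin> U"
  shows "lagrange_poly (nsets (insert v U) (Suc k)) x
       = lagrange_poly (nsets U (Suc k)) x + x v * lagrange_poly (nsets U k) x"
proof -
  have 1: "{e \<in> nsets (insert v U) (Suc k). v \<notin> e} = nsets U (Suc k)"
    using assms by (auto simp: nsets_def)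
  have "link (nsets (insert v U) (Suc k)) v = nsets U k"
  proof
    show "link (nsets (insert v U) (Suc k)) v \<subseteq> nsets U k"
      using link_nsets_subset[of "nsets (insert v U) (Suc k)" "insert v U" k v] assms by simp
    show "nsets U k \<subseteq> link (nsets (insert v U) (Suc k)) v"
    proof
      fix e assume e: "e \<in> nsets U k"
      then have "v \<notin> e" using assms by (auto simp: nsets_def)
      then have "e = insert v e - {v}" "insert v e \<in> nsets (insert v U) (Suc k)"
        using e by (auto simp: nsets_def)
      then show "e \<in> link (nsets (insert v U) (Suc k)) v"
        unfolding link_def by blast
    qed
  qed
  moreover have "finite (nsets (insert v U) (Suc k))"
    using assms(1) by (intro finite_imp_finite_nsets) simp
  moreover have "finite e" if "e \<in> nsets (insert v U) (Suc k)" for e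
    using that by (simp add: nsets_def)
  ultimately show ?thesis
    using lagrange_poly_link[of "nsets (insert v U) (Suc k)" x v] 1 by metis
qed

lemma lagrange_poly_nsets_1: "lagrange_poly (nsets U (Suc 0)) x = sum x U"
  by (simp add: nsets_one lagrange_poly_def sum.reindex inj_on_def)

lemma lagrange_poly_nsets_2_insert:
  assumes "finite U" "v \<notin> U"
  shows "lagrange_poly (nsets (insert v U) 2) x = lagrange_poly (nsets U 2) x + x v * sum x U"
  using lagrange_poly_nsets_insert[OF assms, of "Suc 0" x]
  unfolding lagrange_poly_nsets_1 numeral_2_eq_2 .

lemma lagrange_poly_nsets_3_insert:
  assumes "finite U" "v \<notin> U"
  shows "lagrange_poly (nsets (insert v U) 3) x
       = lagrange_poly (nsets U 3) x + x v * lagrange_poly (nsets U 2) x"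
  using lagrange_poly_nsets_insert[OF assms, of 2 x] unfolding numeral_3_eq_3 numeral_2_eq_2 .

text \<open>
  Maclaurin's inequalities for the second and third elementary symmetric function, by adding the
  variables one at a time. Once the previous inequality is inserted, the two sides of each step
  differ by a nonnegative multiple of the square of \<open>card U * x v - sum x U\<close>, which vanishes when the new variable equals the mean of the
  others. The denominators are cleared so that the empty set is covered as well.
\<close>

lemma maclaurin_nsets_2:
  assumes "finite U"
  shows "2 * card U * lagrange_poly (nsets U 2) x \<le> (real (card U) - 1) * (sum x U)\<^sup>2"
  using assms
proof (induction U)
  case empty
  then show ?case by (simp add: nsets_def)
next
  case (insert v U)
  define n s e b where "n = real (card U)" and "s = sum x U"
    and "e = lagrange_poly (nsets U 2) x" and "b = x v"
  have IH: "2 * n * e \<le> (n - 1) * s\<^sup>2" using insert.IH by (simp add: n_def s_def e_def)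
  have "2 * (n + 1) * (e + b * s) \<le> n * (b + s)\<^sup>2"
  proof (cases "U = {}")
    case True
    then show ?thesis by (simp add: n_def s_def e_def lagrange_poly_def nsets_empty_iff)
  next
    case False
    then have "n > 0" using insert.hyps by (simp add: n_def card_gt_0_iff)
    have "n * (2 * (n + 1) * (e + b * s)) = (n + 1) * (2 * n * e) + 2 * n * (n + 1) * b * s"
      by (simp add: algebra_simps)
    also have "\<dots> \<le> (n + 1) * ((n - 1) * s\<^sup>2) + 2 * n * (n + 1) * b * s"
      using IH \<open>n > 0\<close> by (intro add_right_mono mult_left_mono) auto
    also have "\<dots> = n * (n * (b + s)\<^sup>2) - (n * b - s)\<^sup>2"
      by (simp add: algebra_simps power2_eq_square)
    also have "\<dots> \<le> n * (n * (b + s)\<^sup>2)" by simp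
    finally show ?thesis using \<open>n > 0\<close> by simp
  qed
  then show ?case
    using insert.hyps
    by (simp add: lagrange_poly_nsets_2_insert n_def s_def e_def b_def algebra_simps)
qed

lemma maclaurin_nsets_3:
  assumes "finite U" "\<And>i. i \<in> U \<Longrightarrow> 0 \<le> x i"
  shows "6 * (card U)\<^sup>2 * lagrange_poly (nsets U 3) x
       \<le> (real (card U) - 1) * (real (card U) - 2) * (sum x U) ^ 3"
  using assms
proof (induction U)
  case empty
  then show ?case by (simp add: nsets_def)
next
  case (insert v U)
  define n s e e' b where "n = real (card U)" and "s = sum x U"
    and "e = lagrange_poly (nsets U 3) x" and "e' = lagrange_poly (nsets U 2) x" and "b = x v"
  have IH: "6 * n\<^sup>2 * e \<le> (n - 1) * (n - 2) * s ^ 3"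
    using insert by (simp add: n_def s_def e_def)
  have e': "2 * n * e' \<le> (n - 1) * s\<^sup>2"
    using maclaurin_nsets_2[OF insert.hyps(1), of x] by (simp add: n_def s_def e'_def)
  have "b \<ge> 0" "s \<ge> 0"
    using insert.prems by (auto simp: b_def s_def intro: sum_nonneg)
  have "6 * (n + 1)\<^sup>2 * (e + b * e') \<le> n * (n - 1) * (b + s) ^ 3"
  proof (cases "U = {}")
    case True
    then show ?thesis by (simp add: n_def s_def e_def e'_def lagrange_poly_def nsets_empty_iff)
  next
    case False
    then have "n \<ge> 1" using insert.hyps by (simp add: n_def Suc_le_eq card_gt_0_iff)
    have "n\<^sup>2 * (6 * (n + 1)\<^sup>2 * (e + b * e'))
        = (n + 1)\<^sup>2 * (6 * n\<^sup>2 * e) + 3 * n * (n + 1)\<^sup>2 * b * (2 * n * e')"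
      by (simp add: algebra_simps power2_eq_square)
    also have "\<dots> \<le> (n + 1)\<^sup>2 * ((n - 1) * (n - 2) * s ^ 3) + 3 * n * (n + 1)\<^sup>2 * b * ((n - 1) * s\<^sup>2)"
      using IH e' \<open>n \<ge> 1\<close> \<open>b \<ge> 0\<close> by (intro add_mono mult_left_mono) auto
    also have "\<dots> = n\<^sup>2 * (n * (n - 1) * (b + s) ^ 3)
        - (n - 1) * (n * b - s)\<^sup>2 * (n * b + (3 * n + 2) * s)"
      by (simp add: algebra_simps power2_eq_square power3_eq_cube)
    also have "\<dots> \<le> n\<^sup>2 * (n * (n - 1) * (b + s) ^ 3)"
      using \<open>n \<ge> 1\<close> \<open>b \<ge> 0\<close> \<open>s \<ge> 0\<close> by simp
    finally show ?thesis using \<open>n \<ge> 1\<close> by simp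
  qed
  then show ?case
    using insert.hyps
    by (simp add: lagrange_poly_nsets_3_insert n_def s_def e_def e'_def b_def algebra_simps)
qed

lemma choose_2_real: "2 * real (n choose 2) = real n * (real n - 1)"
  by (induction n) (auto simp: numeral_2_eq_2 algebra_simps)

lemma choose_3_real: "6 * real (n choose 3) = real n * (real n - 1) * (real n - 2)"
proof (induction n)
  case (Suc n)
  have "Suc n choose 3 = (n choose 2) + (n choose 3)"
    by (simp add: numeral_3_eq_3 numeral_2_eq_2)
  then show ?case using Suc.IH choose_2_real[of n] by (simp add: algebra_simps)
qed simp

lemma lagrange_poly_complete_le:
  assumes "x \<in> weightings U" "finite U"
  shows "lagrange_poly (nsets U 3) x \<le> real (card U choose 3) / real (card U) ^ 3"
proof -
  define n where "n = real (card U)"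
  have "U \<noteq> {}" using assms by (auto simp: weightings_def)
  then have n: "n > 0" using assms(2) by (simp add: n_def card_gt_0_iff)
  have "6 * n\<^sup>2 * lagrange_poly (nsets U 3) x \<le> (n - 1) * (n - 2)"
    using maclaurin_nsets_3[OF assms(2), of x] assms(1) by (auto simp: weightings_def n_def)
  then have "n * (6 * n\<^sup>2 * lagrange_poly (nsets U 3) x) \<le> n * ((n - 1) * (n - 2))"
    using n by (intro mult_left_mono) auto
  then have "n ^ 3 * lagrange_poly (nsets U 3) x \<le> real (card U choose 3)"
    using choose_3_real[of "card U"] by (simp add: n_def power3_eq_cube power2_eq_square algebra_simps)
  then show ?thesis using n unfolding n_def by (simp add: field_simps)
qed

text \<open>
  Such a weighting lives on the other vertices, where no 3-graph beats the complete one.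
\<close>

lemma lagrange_poly_le_of_zero_coordinate:
  assumes G: "three_graph V E" and x: "x \<in> weightings V" and i: "i \<in> V" "x i = 0"
  shows "lagrange_poly E x \<le> real ((card V - 1) choose 3) / real (card V - 1) ^ 3"
proof -
  define U where "U = V - {i}"
  have U: "finite U" "i \<notin> U" "insert i U = V" "card U = card V - 1"
    using three_graphD(1)[OF G] i by (auto simp: U_def)
  have "lagrange_poly E x \<le> lagrange_poly (nsets V 3) x"
    using three_graphD[OF G] x
    by (intro lagrange_poly_mono finite_imp_finite_nsets) (auto simp: nsets_def weightings_def)
  also have "\<dots> = lagrange_poly (nsets U 3) x"
    using lagrange_poly_nsets_3_insert[OF U(1,2), of x] i U(3) by simp
  also have "sum x V = sum x U"
    using sum.remove[OF three_graphD(1)[OF G] i(1), of x] i(2) by (simp add: U_def)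
  then have "x \<in> weightings U"
    using x by (simp add: weightings_def U_def)
  then have "lagrange_poly (nsets U 3) x \<le> real (card U choose 3) / real (card U) ^ 3"
    using U(1) by (rule lagrange_poly_complete_le)
  finally show ?thesis using U(4) by simp
qed

section \<open>One vertex attached to a complete 3-graph\<close>

lemma extension_without_vertex:
  assumes "three_graph (insert v U) E" "v \<notin> U" "nsets U 3 \<subseteq> E"
  shows "{e \<in> E. v \<notin> e} = nsets U 3"
  using three_graphD(2)[OF assms(1)] assms(2,3) unfolding nsets_def by blast

lemma lagrange_poly_extension:
  assumes "three_graph (insert v U) E" "v \<notin> U" "nsets U 3 \<subseteq> E"
  shows "lagrange_poly E x = lagrange_poly (nsets U 3) x + x v * lagrange_poly (link E v) x"
  using lagrange_poly_link[of E x v] three_graphD(3,4)[OF assms(1)] extension_without_vertex[OF assms]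
  by simp

lemma card_extension:
  assumes "three_graph (insert v U) E" "v \<notin> U" "nsets U 3 \<subseteq> E"
  shows "card E = (card U choose 3) + card (link E v)"
proof -
  have "card E = card {e \<in> E. v \<notin> e} + card {e \<in> E. v \<in> e}"
    using three_graphD(3)[OF assms(1)] by (subst card_Un_disjoint[symmetric]) (auto intro: arg_cong[of _ _ card])
  then show ?thesis by (simp add: extension_without_vertex[OF assms] card_link)
qed

lemma link_extension:
  assumes "three_graph (insert v U) E" "v \<notin> U"
  shows "link E v \<subseteq> nsets U 2"
  using link_nsets_subset[of E "insert v U" 2 v] three_graphD(2)[OF assms(1)] assms(2)
  by (simp add: numeral_3_eq_3 numeral_2_eq_2)

lemma link_extension_other:
  assumes G: "three_graph (insert v U) E" and v: "v \<notin> U" and K: "nsets U 3 \<subseteq> E" and i: "i \<in> U"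
  shows "link E i = nsets (U - {i}) 2 \<union> (\<lambda>k. {v, k}) ` {k \<in> U - {i}. {v, i, k} \<in> E}"
proof
  show "link E i \<subseteq> nsets (U - {i}) 2 \<union> (\<lambda>k. {v, k}) ` {k \<in> U - {i}. {v, i, k} \<in> E}"
  proof
    fix p assume "p \<in> link E i"
    then obtain e where e: "e \<in> E" "i \<in> e" "p = e - {i}" by (auto simp: link_def)
    then have e3: "e \<subseteq> insert v U" "card e = 3" "finite e"
      using three_graphD(2)[OF G] by (auto simp: nsets_def)
    show "p \<in> nsets (U - {i}) 2 \<union> (\<lambda>k. {v, k}) ` {k \<in> U - {i}. {v, i, k} \<in> E}"
    proof (cases "v \<in> e")
      case False
      then show ?thesis using e e3 by (auto simp: nsets_def)
    next
      case True
      have "v \<noteq> i" using v i by auto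
      then have "card (e - {v, i}) = 1" using True e e3 by (subst card_Diff_subset) auto
      then obtain k where "e - {v, i} = {k}" by (auto simp: card_1_singleton_iff)
      then have "e = {v, i, k}" "k \<noteq> v" "k \<noteq> i" using True e by auto
      then show ?thesis using e e3 \<open>v \<noteq> i\<close> by auto
    qed
  qed
next
  have "p \<in> link E i" if "p \<in> nsets (U - {i}) 2" for p
  proof -
    have p: "p \<subseteq> U" "i \<notin> p" "finite p" "card p = 2" using that by (auto simp: nsets_def)
    then have "insert i p \<in> nsets U 3" using i by (simp add: nsets_def)
    then have "insert i p \<in> {e \<in> E. i \<in> e}" using K by blast
    moreover have "p = insert i p - {i}" using p by blast
    ultimately show ?thesis unfolding link_def by blast
  qed
  moreover have "{v, k} \<in> link E i" if "k \<in> U - {i}" "{v, i, k} \<in> E" for k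
    unfolding link_def using that v i by (intro image_eqI[of _ _ "{v, i, k}"]) auto
  ultimately show "nsets (U - {i}) 2 \<union> (\<lambda>k. {v, k}) ` {k \<in> U - {i}. {v, i, k} \<in> E} \<subseteq> link E i"
    by blast
qed

lemma lagrange_poly_link_extension_other:
  assumes G: "three_graph (insert v U) E" and v: "v \<notin> U" and K: "nsets U 3 \<subseteq> E" and i: "i \<in> U"
  shows "lagrange_poly (link E i) x
       = lagrange_poly (nsets (U - {i}) 2) x + x v * sum x {k \<in> U - {i}. {v, i, k} \<in> E}"
proof -
  have "finite U" using three_graphD(1)[OF G] by simp
  have "v \<notin> {k \<in> U - {i}. {v, i, k} \<in> E}" using v by simp
  from lagrange_poly_pairs[OF this, of x] show ?thesis
    unfolding link_extension_other[OF assms]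
    using \<open>finite U\<close> v
    by (subst lagrange_poly_Un_disjoint) (auto intro: finite_imp_finite_nsets simp: nsets_def)
qed

text \<open>
  If no edge contains both \<open>v\<close> and \<open>u\<close>, the link of \<open>v\<close> is contained in the link of \<open>u\<close>. Hence the
  weight of \<open>v\<close> is at least as useful when it is moved to \<open>u\<close>, and then only the complete 3-graph
  on \<open>U\<close> is left.
\<close>

lemma lagrange_poly_le_of_uncovered_pair:
  assumes G: "three_graph (insert v U) E" and v: "v \<notin> U" and K: "nsets U 3 \<subseteq> E"
    and u: "u \<in> U" "\<And>e. e \<in> E \<Longrightarrow> \<not> {v, u} \<subseteq> e" and x: "x \<in> weightings (insert v U)"
  shows "lagrange_poly E x \<le> real (card U choose 3) / real (card U) ^ 3"
proof -
  define W where "W = U - {u}"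
  define y where "y = x(u := x u + x v)"
  have W: "finite W" "u \<notin> W" "insert u W = U"
    using three_graphD(1)[OF G] u by (auto simp: W_def)
  have x0: "0 \<le> x i" if "i \<in> insert v U" for i using x that by (auto simp: weightings_def)
  have "link E v \<subseteq> nsets W 2"
  proof
    fix p assume p: "p \<in> link E v"
    then obtain e where "e \<in> E" "v \<in> e" "p = e - {v}" by (auto simp: link_def)
    then have "u \<notin> p" using u(2) by blast
    then show "p \<in> nsets W 2" using link_extension[OF G v] p by (auto simp: W_def nsets_def)
  qed
  then have le: "lagrange_poly (link E v) x \<le> lagrange_poly (nsets W 2) x"
    using W x0 by (intro lagrange_poly_mono) (auto simp: finite_imp_finite_nsets nsets_def)
  have eq: "lagrange_poly (nsets W k) y = lagrange_poly (nsets W k) x" for k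
    using W(2) by (intro lagrange_poly_cong) (auto simp: y_def nsets_def)
  have "lagrange_poly E x = lagrange_poly (nsets W 3) x + x u * lagrange_poly (nsets W 2) x
      + x v * lagrange_poly (link E v) x"
    using lagrange_poly_extension[OF G v K, of x] lagrange_poly_nsets_3_insert[OF W(1,2), of x] W(3)
    by simp
  also have "\<dots> \<le> lagrange_poly (nsets W 3) x + x u * lagrange_poly (nsets W 2) x
      + x v * lagrange_poly (nsets W 2) x"
    using le x0 by (intro add_left_mono mult_left_mono) auto
  also have "\<dots> = lagrange_poly (nsets U 3) y"
    using lagrange_poly_nsets_3_insert[OF W(1,2), of y] W(3)
    by (simp add: eq[unfolded y_def] y_def algebra_simps)
  also have "y \<in> weightings U"
  proof -
    have "sum y W = sum x W" using W(2) by (intro sum.cong) (auto simp: y_def)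
    moreover have "sum y U = y u + sum y W" "sum x U = x u + sum x W"
      using sum.insert[OF W(1,2), of y] sum.insert[OF W(1,2), of x] W(3) by simp_all
    moreover have "sum x (insert v U) = x v + sum x U"
      using three_graphD(1)[OF G] v by simp
    ultimately have "sum y U = sum x (insert v U)" by (simp add: y_def)
    then show ?thesis using x x0 u(1) by (simp add: weightings_def y_def)
  qed
  then have "lagrange_poly (nsets U 3) y \<le> real (card U choose 3) / real (card U) ^ 3"
    using three_graphD(1)[OF G] by (intro lagrange_poly_complete_le) auto
  finally show ?thesis .
qed

text \<open>
  This is the heart of the matter. Let \<open>M\<close> be the set of vertices that form an edge with \<open>v\<close> and \<open>u\<close>,
  and \<open>N\<close> the rest of \<open>U - {u}\<close>. The set \<open>F\<close> of pairs missing from the link of \<open>v\<close> consists of the pairs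
  \<open>{u, k}\<close> with \<open>k \<in> N\<close> and the set \<open>D\<close> of those that avoid \<open>u\<close>. If \<open>F\<close> has at least
  \<open>card U - 1 = card M + card N\<close> elements, then \<open>card M \<le> card D\<close>.

  Write \<open>a\<close>, \<open>y\<close>, \<open>z\<close> for the weights of \<open>u\<close>, \<open>v\<close> and a heaviest \<open>w \<in> M\<close>, write \<open>S\<close> and \<open>X\<close> for the
  weights of \<open>N\<close> and \<open>M\<close>, and \<open>d\<close> for the value of the pairs in \<open>D\<close>. As \<open>u\<close> is lightest, \<open>d\<close> is at
  least \<open>card M * a\<^sup>2\<close>. Equality of the derivatives at \<open>v\<close> and \<open>u\<close> means \<open>(a - y) * X = d\<close>, and
  with \<open>X \<le> card M * z\<close> this gives \<open>a\<^sup>2 \<le> (a - y) * z\<close>, whence \<open>y < z - a\<close>: the vertex \<open>w\<close> is much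
  heavier than \<open>u\<close>. Equality of the derivatives at \<open>u\<close> and \<open>w\<close> implies
  \<open>(z - a) * (S + X - z) \<le> y * (a + S - z)\<close>: the vertex \<open>w\<close> can be that heavy only if its link
  contains much more at \<open>v\<close> than the link of \<open>u\<close> does. Since \<open>z \<le> X\<close>, the two conditions exclude
  each other.
\<close>

lemma card_link_of_positive_optimum:
  assumes G: "three_graph (insert v U) E" and v: "v \<notin> U" and K: "nsets U 3 \<subseteq> E"
    and x: "x \<in> weightings (insert v U)"
    and opt: "\<And>z. z \<in> weightings (insert v U) \<Longrightarrow> lagrange_poly E z \<le> lagrange_poly E x"
    and pos: "\<And>i. i \<in> insert v U \<Longrightarrow> 0 < x i"
    and u: "u \<in> U" "\<And>i. i \<in> U \<Longrightarrow> x u \<le> x i"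
    and edge: "e \<in> E" "{v, u} \<subseteq> e"
  shows "(card U - 1) choose 2 < card (link E v)"
proof (rule ccontr)
  assume few: "\<not> ?thesis"
  define M where "M = {k \<in> U - {u}. {v, u, k} \<in> E}"
  define N where "N = {k \<in> U - {u}. {v, u, k} \<notin> E}"
  define F where "F = nsets U 2 - link E v"
  define D where "D = {p \<in> F. u \<notin> p}"
  define e2 where "e2 = lagrange_poly (nsets U 2) x"
  have finU: "finite U" using three_graphD(1)[OF G] by simp
  have finF: "finite F" using finU by (simp add: F_def finite_imp_finite_nsets)
  have MN: "finite M" "finite N" "M \<inter> N = {}" "U - {u} = M \<union> N" "card M + card N = card U - 1"
  proof -
    show *: "finite M" "finite N" "M \<inter> N = {}" "U - {u} = M \<union> N"
      using finU by (auto simp: M_def N_def)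
    have "card M + card N = card (U - {u})" using * by (simp add: card_Un_disjoint)
    then show "card M + card N = card U - 1" using u(1) finU by simp
  qed
  have "v \<noteq> u" using v u by auto
  have "M \<noteq> {}"
  proof -
    have e: "e \<subseteq> insert v U" "card e = 3" "finite e"
      using edge(1) three_graphD(2)[OF G] by (auto simp: nsets_def)
    then have "card (e - {v, u}) = 1" using edge(2) \<open>v \<noteq> u\<close> by (subst card_Diff_subset) auto
    then obtain k where "e - {v, u} = {k}" by (auto simp: card_1_singleton_iff)
    then have "e = {v, u, k}" "k \<noteq> v" "k \<noteq> u" using edge(2) by auto
    then have "k \<in> M" using edge(1) e(1) by (auto simp: M_def)
    then show ?thesis by blast
  qed
  then obtain w where w: "w \<in> M" "\<And>k. k \<in> M \<Longrightarrow> x k \<le> x w"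
    using MN(1) obtains_MAX[of M x] by (metis Max_ge finite_imageI imageI)
  have wU: "w \<in> U" "w \<noteq> u" using w by (auto simp: M_def)
  \<comment> \<open>The pairs at \<open>u\<close> that are missing from the link of \<open>v\<close> correspond to \<open>N\<close>.\<close>
  have F_eq: "F = (\<lambda>k. {u, k}) ` N \<union> D"
  proof -
    have link_iff: "{u, k} \<in> link E v \<longleftrightarrow> {v, u, k} \<in> E" if "k \<in> U - {u}" for k
    proof
      assume "{u, k} \<in> link E v"
      then obtain f where "f \<in> E" "v \<in> f" "{u, k} = f - {v}" by (auto simp: link_def)
      then have "f = {v, u, k}" by auto
      then show "{v, u, k} \<in> E" using \<open>f \<in> E\<close> by simp
    next
      assume "{v, u, k} \<in> E"
      then show "{u, k} \<in> link E v"
        unfolding link_def using that v \<open>v \<noteq> u\<close> by (intro image_eqI[of _ _ "{v, u, k}"]) auto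
    qed
    have "p \<in> (\<lambda>k. {u, k}) ` N" if p: "p \<in> F" "u \<in> p" for p
    proof -
      have "p \<in> nsets U 2" using p by (simp add: F_def)
      then obtain k where "p = {u, k}" "k \<in> U - {u}"
        using p(2) by (elim nsets2_E) (auto simp: insert_commute)
      then show ?thesis using p(1) link_iff by (auto simp: N_def F_def)
    qed
    moreover have "{u, k} \<in> F" if "k \<in> N" for k
      using that link_iff[of k] u(1) by (auto simp: N_def F_def)
    ultimately show ?thesis by (auto simp: D_def)
  qed
  have disj: "(\<lambda>k. {u, k}) ` N \<inter> D = {}" by (auto simp: D_def)
  have finD: "finite D" using finF by (simp add: D_def)
  \<comment> \<open>This is the only step that uses the bound on the size of the link.\<close>
  have "card M \<le> card D"
  proof -
    have "card F = (card U choose 2) - card (link E v)"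
      using link_extension[OF G v] finU unfolding F_def
      by (subst card_Diff_subset) (auto intro: finite_subset finite_imp_finite_nsets)
    moreover have "card U choose 2 = ((card U - 1) choose 2) + (card U - 1)"
      using u(1) finU by (cases "card U") (auto simp: numeral_2_eq_2)
    ultimately have "card U - 1 \<le> card F" using few by linarith
    moreover have "card F = card N + card D"
    proof -
      have "inj_on (\<lambda>k. {u, k}) N" unfolding inj_on_def doubleton_eq_iff by blast
      then show ?thesis
        using disj finD MN(2) unfolding F_eq by (simp add: card_Un_disjoint card_image)
    qed
    ultimately show ?thesis using MN(5) by simp
  qed
  define a y z where "a = x u" and "y = x v" and "z = x w"
  define c S X d where "c = real (card M)" and "S = sum x N" and "X = sum x M"
    and "d = lagrange_poly D x"
  have "a > 0" "y > 0" "z > 0" using pos u(1) wU by (auto simp: a_def y_def z_def)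
  have "c > 0" using \<open>M \<noteq> {}\<close> MN(1) by (simp add: c_def card_gt_0_iff)
  have "S \<ge> 0" unfolding S_def using pos by (intro sum_nonneg) (auto simp: N_def less_imp_le)
  have "z \<le> X" unfolding z_def X_def
    using w MN(1) pos by (intro member_le_sum) (auto simp: M_def less_imp_le)
  have "X \<le> c * z" unfolding X_def c_def z_def
    using sum_bounded_above[of M x "x w"] w(2) by auto
  have "c * a\<^sup>2 \<le> d"
  proof -
    have "real (card D) * a\<^sup>2 \<le> d"
      unfolding d_def
    proof (rule lagrange_poly_ge_const)
      show "D \<subseteq> nsets U 2" by (auto simp: D_def F_def)
    qed (use u(2) \<open>a > 0\<close> in \<open>auto simp: a_def\<close>)
    moreover have "c * a\<^sup>2 \<le> real (card D) * a\<^sup>2"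
      using \<open>card M \<le> card D\<close> by (intro mult_right_mono) (auto simp: c_def)
    ultimately show ?thesis by simp
  qed
  have sum_u: "sum x (U - {u}) = S + X"
    using MN by (simp add: sum.union_disjoint S_def X_def)
  \<comment> \<open>The partial derivatives at \<open>v\<close>, \<open>u\<close> and \<open>w\<close>, all expressed through \<open>e2\<close>.\<close>
  have dv: "lagrange_poly (link E v) x = e2 - (a * S + d)"
  proof -
    have "nsets U 2 = link E v \<union> F" using link_extension[OF G v] by (auto simp: F_def)
    moreover have "finite (link E v)"
      using link_extension[OF G v] finU by (meson finite_imp_finite_nsets finite_subset)
    moreover have "link E v \<inter> F = {}" by (auto simp: F_def)
    ultimately have "e2 = lagrange_poly (link E v) x + lagrange_poly F x"
      using lagrange_poly_Un_disjoint finF by (metis e2_def)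
    moreover have "lagrange_poly F x = a * S + d"
    proof -
      have "lagrange_poly F x = lagrange_poly ((\<lambda>k. {u, k}) ` N) x + lagrange_poly D x"
        unfolding F_eq using MN(2) finD disj by (intro lagrange_poly_Un_disjoint) auto
      moreover have "u \<notin> N" by (simp add: N_def)
      ultimately show ?thesis
        using lagrange_poly_pairs[of u N x] by (simp add: a_def S_def d_def)
    qed
    ultimately show ?thesis by simp
  qed
  have e2_remove: "e2 = lagrange_poly (nsets (U - {i}) 2) x + x i * sum x (U - {i})" if "i \<in> U" for i
    using lagrange_poly_nsets_2_insert[of "U - {i}" i x] that finU by (simp add: e2_def insert_absorb)
  have du: "lagrange_poly (link E u) x = e2 - a * (S + X) + y * X"
    using lagrange_poly_link_extension_other[OF G v K u(1), of x] e2_remove[OF u(1)] sum_u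
    by (simp add: a_def y_def X_def M_def)
  define g where "g = sum x {k \<in> U - {w}. {v, w, k} \<in> E}"
  have sum_w: "sum x (U - {w}) = a + S + X - z"
    using sum_u sum.remove[OF finU u(1), of x] sum.remove[OF finU wU(1), of x]
    by (simp add: a_def z_def)
  have "g \<le> a + S + X - z"
    unfolding g_def sum_w[symmetric] using finU pos by (intro sum_mono2) (auto simp: less_imp_le)
  then have "y * g \<le> y * (a + S + X - z)" using \<open>y > 0\<close> by simp
  moreover have "lagrange_poly (link E w) x = e2 - z * (a + S + X - z) + y * g"
    using lagrange_poly_link_extension_other[OF G v K wU(1), of x] e2_remove[OF wU(1)] sum_w
    by (simp add: z_def y_def g_def)
  ultimately have dw: "lagrange_poly (link E w) x \<le> e2 - z * (a + S + X - z) + y * (a + S + X - z)"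
    by simp
  have links: "lagrange_poly (link E i) x = lagrange_poly (link E u) x" if "i \<in> insert v U" for i
    using optimum_link_le[OF G x opt, of i u] optimum_link_le[OF G x opt, of u i] that u(1) pos
    by (intro antisym) auto
  \<comment> \<open>The derivatives at \<open>v\<close> and \<open>u\<close> agree.\<close>
  have d_eq: "(a - y) * X = d"
    using links[of v] dv du by (simp add: algebra_simps)
  have "X > 0" "d > 0"
    using \<open>z \<le> X\<close> \<open>z > 0\<close> \<open>c * a\<^sup>2 \<le> d\<close> \<open>c > 0\<close> \<open>a > 0\<close>
    by (auto intro: less_le_trans[OF _ \<open>c * a\<^sup>2 \<le> d\<close>])
  then have "a > y" using d_eq by (metis diff_gt_0_iff_gt zero_less_mult_pos2)
  have "c * a\<^sup>2 \<le> (a - y) * (c * z)"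
    using \<open>c * a\<^sup>2 \<le> d\<close> d_eq mult_left_mono[OF \<open>X \<le> c * z\<close>, of "a - y"] \<open>a > y\<close> by simp
  then have "c * a\<^sup>2 \<le> c * ((a - y) * z)" by (simp add: algebra_simps)
  then have az: "a\<^sup>2 \<le> (a - y) * z" using \<open>c > 0\<close> by simp
  have "(a - y) * z < a * z" using \<open>y > 0\<close> \<open>z > 0\<close> by simp
  with az have "a * a < a * z" by (simp add: power2_eq_square)
  then have "a < z" using \<open>a > 0\<close> by simp
  have "a * y < z * y" using \<open>a < z\<close> \<open>y > 0\<close> by simp
  then have "a * y < a * (z - a)" using az by (simp add: power2_eq_square algebra_simps)
  then have "y < z - a" using \<open>a > 0\<close> by simp
  \<comment> \<open>The derivatives at \<open>u\<close> and \<open>w\<close> agree.\<close>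
  have "(z - a) * (S + X - z) \<le> y * (a + S - z)"
    using links[of w] wU du dw by (simp add: algebra_simps)
  moreover have "(z - a) * S \<le> (z - a) * (S + X - z)"
    using \<open>z \<le> X\<close> \<open>a < z\<close> by (intro mult_left_mono) auto
  ultimately have "(z - a) * (S + y) \<le> y * S" by (simp add: algebra_simps)
  moreover have "y * (S + y) < (z - a) * (S + y)"
    using \<open>y < z - a\<close> \<open>S \<ge> 0\<close> \<open>y > 0\<close> by simp
  moreover have "y * S < y * (S + y)" using \<open>y > 0\<close> by simp
  ultimately show False by linarith
qed

lemma lagrangian_extension_le:
  assumes G: "three_graph (insert v U) E" and v: "v \<notin> U" and K: "nsets U 3 \<subseteq> E"
    and few: "card (link E v) \<le> (card U - 1) choose 2"
  shows "lagrangian (insert v U) E \<le> real (card U choose 3) / real (card U) ^ 3"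
proof -
  have finU: "finite U" using three_graphD(1)[OF G] by simp
  obtain x where x: "x \<in> weightings (insert v U)" and L: "lagrange_poly E x = lagrangian (insert v U) E"
    and opt: "\<And>z. z \<in> weightings (insert v U) \<Longrightarrow> lagrange_poly E z \<le> lagrange_poly E x"
    using lagrangian_attained[OF G] by auto
  show ?thesis
  proof (cases "U = {}")
    case True
    then have "E = {}" using three_graphD(2)[OF G] by (simp add: nsets_singleton_iff)
    then show ?thesis using L by (simp add: lagrange_poly_def)
  next
    case False
    show ?thesis
    proof (cases "\<exists>i\<in>insert v U. x i = 0")
      case True
      then show ?thesis
        using lagrange_poly_le_of_zero_coordinate[OF G x] L v finU by auto
    next
      case nonzero: False
      then have pos: "0 < x i" if "i \<in> insert v U" for i
        using x that by (force simp: weightings_def less_le)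
      obtain u where u: "u \<in> U" "\<And>i. i \<in> U \<Longrightarrow> x u \<le> x i"
        using finU False by (metis arg_min_if_finite(1) arg_min_least)
      show ?thesis
      proof (cases "\<exists>e\<in>E. {v, u} \<subseteq> e")
        case True
        then show ?thesis
          using card_link_of_positive_optimum[OF G v K x opt pos u] few by fastforce
      next
        case False
        then show ?thesis using lagrange_poly_le_of_uncovered_pair[OF G v K u(1) _ x] L by auto
      qed
    qed
  qed
qed

section \<open>Density\<close>

lemma lagrangian_complete_ge:
  assumes "finite U" "U \<noteq> {}"
  shows "real (card U choose 3) / real (card U) ^ 3 \<le> lagrangian U (nsets U 3)"
proof -
  define x where "x = (\<lambda>i::'a. 1 / real (card U))"
  have "x \<in> weightings U" using assms by (simp add: x_def weightings_def)
  moreover have "three_graph U (nsets U 3)" using assms by (simp add: three_graph_def)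
  ultimately have "lagrange_poly (nsets U 3) x \<le> lagrangian U (nsets U 3)"
    using lagrangian_attained[of U "nsets U 3"] assms(2) by blast
  then show ?thesis
    by (subst (asm) lagrange_poly_const[of _ U 3 _ "1 / real (card U)"]) (auto simp: x_def power_divide)
qed

text \<open>
  The uniform weighting of \<open>U\<close>, extended by zero to \<open>v\<close>, already has the value on the left. It
  violates the first-order condition at \<open>v\<close> and any vertex of \<open>U\<close>, so it is not an optimum.
\<close>

lemma lagrangian_extension_gt:
  assumes G: "three_graph (insert v U) E" and v: "v \<notin> U" and K: "nsets U 3 \<subseteq> E"
    and many: "(card U - 1) choose 2 < card (link E v)"
  shows "real (card U choose 3) / real (card U) ^ 3 < lagrangian (insert v U) E"
proof (rule ccontr)
  assume neg: "\<not> ?thesis"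
  define n where "n = real (card U)"
  define x where "x = (\<lambda>i. if i = v then 0 else 1 / n)"
  have finU: "finite U" using three_graphD(1)[OF G] by simp
  have "U \<noteq> {}"
  proof
    assume "U = {}"
    then have "link E v = {}" using link_extension[OF G v] by (simp add: nsets_empty_iff)
    then show False using many by simp
  qed
  then obtain u where u: "u \<in> U" by blast
  have "n > 0" using finU \<open>U \<noteq> {}\<close> by (simp add: n_def card_gt_0_iff)
  have xU: "x i = 1 / n" if "i \<in> U" for i using that v by (auto simp: x_def)
  have const: "lagrange_poly A x = card A / n ^ k" if "A \<subseteq> nsets U k" for A k
    using lagrange_poly_const[OF that xU] by (simp add: power_divide)
  have "sum x U = 1" using \<open>n > 0\<close> by (simp add: xU n_def)
  then have x: "x \<in> weightings (insert v U)"
    using finU v \<open>n > 0\<close> by (auto simp: weightings_def x_def)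
  have "lagrange_poly E x = real (card U choose 3) / n ^ 3"
    using lagrange_poly_extension[OF G v K, of x] const[of "nsets U 3" 3] by (simp add: x_def)
  then have opt: "lagrange_poly E z \<le> lagrange_poly E x" if "z \<in> weightings (insert v U)" for z
    using neg lagrangian_attained[OF G] that unfolding n_def by fastforce
  have "lagrange_poly (link E v) x \<le> lagrange_poly (link E u) x"
    using optimum_link_le[OF G x opt, of u v] u xU[OF u] \<open>n > 0\<close> by simp
  moreover have "lagrange_poly (link E v) x = card (link E v) / n\<^sup>2"
    using const link_extension[OF G v] by blast
  moreover have "lagrange_poly (link E u) x = real ((card U - 1) choose 2) / n\<^sup>2"
    using lagrange_poly_link_extension_other[OF G v K u, of x]
      const[of "nsets (U - {u}) 2" 2] nsets_mono[of "U - {u}" U 2] u finU by (simp add: x_def)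
  ultimately show False using many \<open>n > 0\<close> by (simp add: divide_le_cancel)
qed

text \<open>
  Extend an optimum weighting of the subgraph by zero to \<open>V\<close>. If it vanishes somewhere on \<open>V\<close>, its
  value is at most the left side of \<open>gt\<close>. Otherwise the subgraph has all the vertices but misses an
  edge, and restoring that edge adds a positive product.
\<close>

lemma dense_if_lagrangian_gt_complete:
  assumes G: "three_graph V E" and "V \<noteq> {}"
    and gt: "real ((card V - 1) choose 3) / real (card V - 1) ^ 3 < lagrangian V E"
  shows "dense_three_graph V E"
  unfolding dense_three_graph_def
proof (intro allI impI)
  fix V' E' assume "proper_subgraph V' E' V E"
  then have G': "three_graph V' E'" and V': "V' \<subseteq> V" and E': "E' \<subseteq> E" and ne: "(V', E') \<noteq> (V, E)"
    by (auto simp: proper_subgraph_def subgraph_def)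
  show "lagrangian V' E' < lagrangian V E"
  proof (cases "V' = {}")
    case True
    have "0 \<le> real ((card V - 1) choose 3) / real (card V - 1) ^ 3" by simp
    moreover have "lagrangian V' E' = 0" using True by (simp add: lagrangian_def)
    ultimately show ?thesis using gt by linarith
  next
    case False
    then obtain x' where x': "x' \<in> weightings V'" and L: "lagrange_poly E' x' = lagrangian V' E'"
      using lagrangian_attained[OF G'] by blast
    define x where "x = (\<lambda>i. if i \<in> V' then x' i else 0)"
    have G'': "three_graph V E'" using G E' by (auto simp: three_graph_def)
    have Lx: "lagrange_poly E' x = lagrangian V' E'"
      unfolding L[symmetric] using three_graphD(5)[OF G'] by (intro lagrange_poly_cong) (auto simp: x_def)
    have "sum x V = sum x V'"
      using three_graphD(1)[OF G] V' by (intro sum.mono_neutral_right) (auto simp: x_def)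
    then have x: "x \<in> weightings V" using x' by (auto simp: weightings_def x_def)
    show ?thesis
    proof (cases "\<exists>i\<in>V. x i = 0")
      case True
      then show ?thesis using lagrange_poly_le_of_zero_coordinate[OF G'' x] Lx gt by fastforce
    next
      case nonzero: False
      then have "V' = V" using V' by (auto simp: x_def split: if_splits)
      then obtain e where e: "e \<in> E" "e \<notin> E'" using ne E' by auto
      have pos: "0 < x i" if "i \<in> V" for i using nonzero x that by (force simp: weightings_def less_le)
      have "0 < (\<Prod>i\<in>e. x i)"
        using e(1) three_graphD(5)[OF G] pos by (intro prod_pos) blast
      then have "lagrange_poly E' x < lagrange_poly (insert e E') x"
        using e(2) three_graphD(3)[OF G''] by (simp add: lagrange_poly_def)
      also have "\<dots> \<le> lagrange_poly E x"
        using three_graphD(3,5)[OF G] e(1) E' pos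
        by (intro lagrange_poly_mono) (auto intro: less_imp_le)
      also have "\<dots> \<le> lagrangian V E" using lagrangian_attained[OF G \<open>V \<noteq> {}\<close>] x by blast
      finally show ?thesis using Lx by simp
    qed
  qed
qed

theorem corollary3p3:
  fixes t m :: nat and E :: "nat set set"
  assumes "t \<ge> 1"
    and "three_graph {1..t} E"
    and "card E = m"
    and "nsets {1..t-1} 3 \<subseteq> E"
  shows "dense_three_graph {1..t} E \<longleftrightarrow>
           m \<ge> ((t - 1) choose 3) + ((t - 2) choose 2) + 1"
proof -
  define U where "U = {1..t-1}"
  have V: "{1..t} = insert t U" using \<open>t \<ge> 1\<close> by (auto simp: U_def)
  have v: "t \<notin> U" and cardU: "card U = t - 1" and "finite U"
    using \<open>t \<ge> 1\<close> by (auto simp: U_def)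
  have G: "three_graph (insert t U) E" and K: "nsets U 3 \<subseteq> E"
    using assms(2,4) V by (simp_all add: U_def)
  have m: "m \<ge> ((t - 1) choose 3) + ((t - 2) choose 2) + 1
      \<longleftrightarrow> (card U - 1) choose 2 < card (link E t)"
    using card_extension[OF G v K] assms(3) by (auto simp: cardU numeral_2_eq_2)
  show ?thesis
    unfolding m
  proof
    assume "(card U - 1) choose 2 < card (link E t)"
    from lagrangian_extension_gt[OF G v K this]
    show "dense_three_graph {1..t} E"
      using G v \<open>finite U\<close> unfolding V by (intro dense_if_lagrangian_gt_complete) auto
  next
    assume dense: "dense_three_graph {1..t} E"
    have "proper_subgraph U (nsets U 3) (insert t U) E"
      using K v \<open>finite U\<close> by (auto simp: proper_subgraph_def subgraph_def three_graph_def)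
    then have lt: "lagrangian U (nsets U 3) < lagrangian (insert t U) E"
      using dense V by (auto simp: dense_three_graph_def)
    show "(card U - 1) choose 2 < card (link E t)"
    proof (rule ccontr)
      assume "\<not> ?thesis"
      then have "lagrangian (insert t U) E \<le> real (card U choose 3) / real (card U) ^ 3"
        by (intro lagrangian_extension_le[OF G v K]) simp
      also have "\<dots> \<le> lagrangian U (nsets U 3)"
      proof (cases "U = {}")
        case False
        then show ?thesis using lagrangian_complete_ge \<open>finite U\<close> by blast
      qed (simp add: lagrangian_def)
      finally show False using lt by simp
    qed
  qed
qed

end
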